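(* Let $d\in\{2,3\}$, let $\mathcal{M}\subset\mathbb{R}^d$ be a map with descriptor map $\mathbf{F}:\mathcal{M}\to\mathbb{R}^n$ and Jacobian $J_{\mathbf{F}}$. For every $T>0$ and every $\mathcal{C}^1$ trajectory $\mathbf{p}:[0,T]\to\mathcal{M}$ such that the pair $(\mathcal{M},\{\mathbf{p}(t)\}_{t\in[0,T]})$ is generic, the observability Gramian $$\mathcal{W}(0,T)=\int_0^TJ_{\mathbf{F}}(\mathbf{p}(t))^\top J_{\mathbf{F}}(\mathbf{p}(t))\,\mathrm{d}t$$ satisfies $\lambda_{\min}(\mathcal{W}(0,T))>0$.
   Context: The descriptor map is $\mathbf{F}(\mathbf{p})=[\phi_1(\mathbf{p}),\dots,\phi_n(\mathbf{p})]^\top$ with $\phi_i(\mathbf{p})=\int_{\mathbb{S}^{d-1}}f_{\mathbf{p}}w_i\,\mathrm{d}\sigma$, where $\sigma$ is the surface measure on the unit sphere $\mathbb{S}^{d-1}$, $f_{\mathbf{p}}:\mathbb{S}^{d-1}\to\mathbb{R}$ is the environment signal at $\mathbf{p}\in\mathcal{M}$, and $w_i(\boldsymbol\theta)=\exp(\boldsymbol\theta^\top\mathbf{d}_i/\varepsilon)/\sum_{j=1}^n\exp(\boldsymbol\theta^\top\mathbf{d}_j/\varepsilon)$ for fixed unit vectors $\mathbf{d}_1,\dots,\mathbf{d}_n$ and $\varepsilon>0$. The signal is assumed such that $\mathbf{F}$ is Fréchet differentiable: for $\sigma$-a.e. $\boldsymbol\theta$ the map $\mathbf{p}\mapsto f_{\mathbf{p}}(\boldsymbol\theta)$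 is differentiable on $\mathcal{M}$, with $\|\nabla_{\mathbf{p}}f_{\mathbf{p}}(\boldsymbol\theta)\|_2\le h(\boldsymbol\theta)$ for all $\mathbf{p}\in\mathcal{M}$ and some $h\in L^1(\mathbb{S}^{d-1})$; $J_{\mathbf{F}}(\mathbf{p})\in\mathbb{R}^{n\times d}$ is its Jacobian. $\lambda_{\min}$ is the smallest eigenvalue. For $\mathbf{u}\in\mathbb{S}^{d-1}$, the pair $(\mathcal{M},\{\mathbf{p}(t)\}_{t\in[0,T]})$ is called $\mathbf{u}$-degenerate if $J_{\mathbf{F}}(\mathbf{p}(t))\mathbf{u}=\mathbf{0}$ for Lebesgue-a.e. $t\in[0,T]$. The pair is called generic if it is not $\mathbf{u}$-degenerate for any $\mathbf{u}\in\mathbb{S}^{d-1}$. *)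

theory Defs
  imports "HOL-Analysis.Analysis"
begin

text \<open>
  Surface measure in polar coordinates: a Borel set \<open>A\<close> of the unit sphere of a
  \<open>d\<close>-dimensional space has surface measure \<open>d\<close> times the Lebesgue measure of the cone
  \<open>{x. 0 < norm x < 1 \<and> x / norm x \<in> A}\<close>.
\<close>

definition sphere_measure :: "'a::euclidean_space measure" where
  "sphere_measure =
     scale_measure (of_nat DIM('a))
       (distr (restrict_space lborel (ball 0 1 - {0})) (restrict_space borel (sphere 0 1))
         (\<lambda>x. x /\<^sub>R norm x))"

lemma space_sphere_measure: "space sphere_measure = sphere 0 1"
  by (simp add: sphere_measure_def space_scale_measure space_restrict_space)

lemma sets_sphere_measure: "sets sphere_measure = sets (restrict_space borel (sphere 0 1))"
  by (simp add: sphere_measure_def)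

lemma radial_projection_measurable:
  "(\<lambda>x::'a::euclidean_space. x /\<^sub>R norm x)
     \<in> measurable (restrict_space lborel (ball 0 1 - {0})) (restrict_space borel (sphere 0 1))"
  by (rule measurable_restrict_space3) (auto simp: borel_measurable_scaleR)

lemma emeasure_sphere_measure:
  fixes A :: "'a::euclidean_space set"
  assumes "A \<in> sets borel" "A \<subseteq> sphere 0 1"
  shows "emeasure sphere_measure A =
    of_nat DIM('a) * emeasure lborel {x \<in> ball 0 1 - {0}. x /\<^sub>R norm x \<in> A}"
proof -
  have A: "A \<in> sets (restrict_space borel (sphere 0 1))"
    using assms by (simp add: sets_restrict_space_iff)
  have eq: "(\<lambda>x. x /\<^sub>R norm x) -` A \<inter> (ball 0 1 - {0}) =
      {x \<in> ball 0 1 - {0}. x /\<^sub>R norm x \<in> A}"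
    by auto
  have "emeasure (restrict_space lborel (ball 0 1 - {0})) {x \<in> ball 0 1 - {0}. x /\<^sub>R norm x \<in> A}
      = emeasure lborel {x \<in> ball 0 1 - {0}. x /\<^sub>R norm x \<in> A}"
    by (rule emeasure_restrict_space) auto
  then show ?thesis
    unfolding sphere_measure_def emeasure_scale_measure
      emeasure_distr[OF radial_projection_measurable A]
    by (simp only: space_restrict_space space_lborel space_borel Int_UNIV_right eq)
qed

lemma emeasure_sphere_measure_sphere:
  "emeasure (sphere_measure :: 'a measure) (sphere (0::'a::euclidean_space) 1) =
     of_nat DIM('a) * ennreal (unit_ball_vol (real DIM('a)))"
proof -
  have "{x::'a \<in> ball 0 1 - {0}. x /\<^sub>R norm x \<in> sphere 0 1} = ball 0 1 - {0}"
    by auto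
  moreover have "emeasure lborel (ball (0::'a) 1 - {0}) = emeasure lborel (ball (0::'a) 1)"
    by (rule emeasure_Diff_null_set) auto
  ultimately show ?thesis
    by (simp add: emeasure_sphere_measure emeasure_ball)
qed

definition descriptor_weight ::
    "('n::finite \<Rightarrow> 'a::euclidean_space) \<Rightarrow> real \<Rightarrow> 'n \<Rightarrow> 'a \<Rightarrow> real" where
  "descriptor_weight D \<epsilon> i \<theta> =
     exp (\<theta> \<bullet> D i / \<epsilon>) / (\<Sum>j\<in>UNIV. exp (\<theta> \<bullet> D j / \<epsilon>))"

text \<open>\<open>f p \<theta>\<close> is the value at \<open>\<theta>\<close> of the environment signal seen from position \<open>p\<close>.\<close>

definition descriptor_map ::
    "('n::finite \<Rightarrow> 'a::euclidean_space) \<Rightarrow> real \<Rightarrow> ('a \<Rightarrow> 'a \<Rightarrow> real) \<Rightarrow> 'a \<Rightarrow> real ^ 'n" where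
  "descriptor_map D \<epsilon> f p =
     (\<chi> i. LINT \<theta>|sphere_measure. f p \<theta> * descriptor_weight D \<epsilon> i \<theta>)"

text \<open>
  Differentiability on a set that need not be open means differentiability on an open
  neighbourhood of it, so that gradients and Jacobians are determined at every point; for open
  \<open>M\<close> one can take \<open>U = M\<close>. Integrability of \<open>f p\<close> says that the integrals
  defining the descriptor map exist.
\<close>

definition admissible_signal ::
    "'a::euclidean_space set \<Rightarrow> ('a \<Rightarrow> 'a \<Rightarrow> real) \<Rightarrow> bool" where
  "admissible_signal M f \<longleftrightarrow>
     (\<exists>U. open U \<and> M \<subseteq> U \<and>
        (\<forall>p\<in>U. integrable sphere_measure (f p)) \<and>
        (\<exists>h. integrable sphere_measure h \<and>
           (AE \<theta> in sphere_measure. \<forall>p\<in>U.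
              \<exists>g. (GDERIV (\<lambda>q. f q \<theta>) p :> g) \<and> norm g \<le> h \<theta>)))"

text \<open>One-sided derivatives at the endpoints.\<close>

definition C1_trajectory ::
    "'a::real_normed_vector set \<Rightarrow> real \<Rightarrow> (real \<Rightarrow> 'a) \<Rightarrow> bool" where
  "C1_trajectory M T p \<longleftrightarrow>
     p ` {0..T} \<subseteq> M \<and>
     (\<exists>v. continuous_on {0..T} v \<and>
        (\<forall>t\<in>{0..T}. (p has_vector_derivative v t) (at t within {0..T})))"

definition degenerate ::
    "(real ^ 'd \<Rightarrow> real ^ 'n) \<Rightarrow> real \<Rightarrow> (real \<Rightarrow> real ^ 'd) \<Rightarrow> real ^ 'd \<Rightarrow> bool" where
  "degenerate F T p u \<longleftrightarrow>
     (AE t in lebesgue_on {0..T}. jacobian F (at (p t)) *v u = 0)"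

definition generic ::
    "(real ^ 'd \<Rightarrow> real ^ 'n) \<Rightarrow> real \<Rightarrow> (real \<Rightarrow> real ^ 'd) \<Rightarrow> bool" where
  "generic F T p \<longleftrightarrow> (\<forall>u\<in>sphere 0 1. \<not> degenerate F T p u)"

definition observability_gramian ::
    "(real ^ 'd \<Rightarrow> real ^ 'n) \<Rightarrow> real \<Rightarrow> (real \<Rightarrow> real ^ 'd) \<Rightarrow> real ^ 'd ^ 'd" where
  "observability_gramian F T p =
     (LINT t|lebesgue_on {0..T}.
        transpose (jacobian F (at (p t))) ** jacobian F (at (p t)))"

text \<open>For symmetric matrices only: their eigenvalues are all real, so that the set is nonempty.\<close>

definition lambda_min :: "real ^ 'd ^ 'd \<Rightarrow> real" where
  "lambda_min A = Min {l. \<exists>v. v \<noteq> 0 \<and> A *v v = l *\<^sub>R v}"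

end

theory Submission
  imports Defs
begin

text \<open>
  For \<open>W = \<integral> J\<^sup>T J\<close> one has \<open>x \<bullet> W x = \<integral> \<parallel>J x\<parallel>\<^sup>2\<close>, which vanishes only if \<open>J x = 0\<close>
  almost everywhere; so genericity makes \<open>W\<close> positive definite. The analytic content is that
  the integral defining \<open>W\<close> converges: dominated differentiation shows that the descriptor map is
  differentiable on an open neighbourhood of \<open>M\<close> with gradients bounded by \<open>\<integral> h\<close>, and the
  Jacobian is measurable as a pointwise limit of difference quotients.
\<close>

section \<open>Eigenvalues of symmetric real matrices\<close>

text \<open>The quadratic form attains its minimum on the compact unit sphere, and a minimiser is an
  eigenvector. The result makes the set under \<open>Min\<close> in \<open>lambda_min\<close>
  nonempty.\<close>

lemma symmetric_matrix_eigenvalue_exists: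
  fixes A :: "real ^ 'd ^ 'd"
  assumes sym: "\<And>x y. x \<bullet> (A *v y) = (A *v x) \<bullet> y"
  shows "\<exists>l v. v \<noteq> 0 \<and> A *v v = l *\<^sub>R v"
proof -
  let ?Q = "\<lambda>x. x \<bullet> (A *v x)"
  have "continuous_on (sphere 0 1) ?Q"
    by (intro continuous_on_inner continuous_on_id matrix_vector_mult_linear_continuous_on)
  moreover have "sphere (0::real^'d) 1 \<noteq> {}"
    using vector_choose_size[of 1] by (auto simp: sphere_def dist_norm)
  ultimately have "\<exists>x\<in>sphere 0 1. \<forall>y\<in>sphere 0 1. ?Q x \<le> ?Q y"
    by (intro continuous_attains_inf compact_sphere)
  then obtain x where x: "x \<in> sphere 0 1" and min: "\<And>y. y \<in> sphere 0 1 \<Longrightarrow> ?Q x \<le> ?Q y"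
    by blast
  define m where "m = ?Q x"
  define z where "z = A *v x - m *\<^sub>R x"
  have xx: "x \<bullet> x = 1" using x by (simp add: dot_square_norm)
  \<comment> \<open>Both sides are homogeneous of degree two, so the minimum on the sphere bounds
    the form everywhere.\<close>
  have psd: "m * (y \<bullet> y) \<le> ?Q y" for y
  proof (cases "y = 0")
    case False
    have "m \<le> ?Q (y /\<^sub>R norm y)"
      unfolding m_def by (rule min) (use False in simp)
    also have "\<dots> = ?Q y / (y \<bullet> y)"
      by (simp add: matrix_vector_mult_scaleR dot_square_norm power2_eq_square divide_simps)
    finally show ?thesis using False by (simp add: divide_simps mult.commute)
  qed simp
  text \<open>The first-order optimality condition at the minimiser of the Rayleigh quotient,
    tested in the direction of the residual \<open>z\<close>.\<close>
  have quad: "0 \<le> 2 * t * (z \<bullet> z) + t\<^sup>2 * (?Q z - m * (z \<bullet> z))" for t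
  proof -
    have "?Q (x + t *\<^sub>R z) - m * ((x + t *\<^sub>R z) \<bullet> (x + t *\<^sub>R z))
        = (?Q x - m * (x \<bullet> x)) + 2 * t * (z \<bullet> (A *v x) - m * (z \<bullet> x)) + t\<^sup>2 * (?Q z - m * (z \<bullet> z))"
      using sym[of x z]
      by (simp add: matrix_vector_right_distrib matrix_vector_mult_scaleR inner_add_left
          inner_add_right inner_commute power2_eq_square algebra_simps)
    also have "z \<bullet> (A *v x) - m * (z \<bullet> x) = z \<bullet> z"
      unfolding z_def by (simp add: inner_diff_right)
    finally show ?thesis using psd[of "x + t *\<^sub>R z"] xx m_def by simp
  qed
  have "z \<bullet> z = 0"
  proof (rule ccontr)
    assume "z \<bullet> z \<noteq> 0"
    then have pos: "z \<bullet> z > 0" by simp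
    let ?c = "?Q z - m * (z \<bullet> z)"
    have c: "?c \<ge> 0" using psd[of z] by simp
    \<comment> \<open>A small negative \<open>t\<close> makes the linear term win. Adding 1 to
      \<open>?c\<close> keeps the denominator positive when \<open>?c = 0\<close>, and with this
      choice the expression collapses to \<open>t * (z \<bullet> z - t)\<close>.\<close>
    define t where "t = - (z \<bullet> z) / (?c + 1)"
    have "t * (?c + 1) = - (z \<bullet> z)" using c by (simp add: t_def)
    moreover have "t < 0" using pos c by (simp add: t_def divide_simps)
    moreover have "2 * t * (z \<bullet> z) + t\<^sup>2 * ?c = t * (2 * (z \<bullet> z) + t * (?c + 1) - t)"
      by (simp add: algebra_simps power2_eq_square)
    ultimately have "2 * t * (z \<bullet> z) + t\<^sup>2 * ?c = t * (z \<bullet> z - t)" by simp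
    also have "\<dots> < 0" using \<open>t < 0\<close> pos by (intro mult_neg_pos) linarith+
    finally show False using quad[of t] by simp
  qed
  then have "A *v x = m *\<^sub>R x" by (simp add: z_def)
  moreover have "x \<noteq> 0" using xx by auto
  ultimately show ?thesis by blast
qed

text \<open>Eigenvectors for distinct eigenvalues are orthogonal, and nonzero pairwise orthogonal
  vectors are independent, so finite dimension leaves room for only finitely many. Together with
  nonemptiness this makes \<open>Min\<close> a true minimum.\<close>

lemma symmetric_matrix_eigenvalues_finite:
  fixes A :: "real ^ 'd ^ 'd"
  assumes sym: "\<And>x y. x \<bullet> (A *v y) = (A *v x) \<bullet> y"
  shows "finite {l. \<exists>v. v \<noteq> 0 \<and> A *v v = l *\<^sub>R v}" (is "finite ?S")
proof -
  have "\<forall>l\<in>?S. \<exists>v. v \<noteq> 0 \<and> A *v v = l *\<^sub>R v" by blast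
  then obtain e where e: "\<And>l. l \<in> ?S \<Longrightarrow> e l \<noteq> 0 \<and> A *v e l = l *\<^sub>R e l"
    using bchoice[of ?S "\<lambda>l v. v \<noteq> 0 \<and> A *v v = l *\<^sub>R v"] by blast
  have orth: "e l \<bullet> e k = 0" if "l \<in> ?S" "k \<in> ?S" "l \<noteq> k" for l k
    using sym[of "e l" "e k"] e[OF that(1)] e[OF that(2)] that(3) by simp
  have inj: "inj_on e ?S"
  proof (rule inj_onI, rule ccontr)
    fix l k assume lk: "l \<in> ?S" "k \<in> ?S" "e l = e k" "l \<noteq> k"
    then have "e l \<bullet> e l = 0" using orth[of l k] by simp
    then show False using e[OF lk(1)] by simp
  qed
  have "pairwise orthogonal (e ` ?S)"
    unfolding pairwise_def orthogonal_def using orth by blast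
  moreover have "0 \<notin> e ` ?S" using e by force
  ultimately have "finite (e ` ?S)"
    using pairwise_orthogonal_independent independent_imp_finite by blast
  then show ?thesis using inj finite_imageD by blast
qed

text \<open>Testing positive definiteness on an eigenvector \<open>v\<close> for \<open>l\<close>
  gives \<open>0 < l * (v \<bullet> v)\<close>, so every element of the set under \<open>Min\<close>
  is positive.\<close>

lemma lambda_min_pos:
  fixes A :: "real ^ 'd ^ 'd"
  assumes sym: "\<And>x y. x \<bullet> (A *v y) = (A *v x) \<bullet> y"
    and pos: "\<And>x. x \<noteq> 0 \<Longrightarrow> 0 < x \<bullet> (A *v x)"
  shows "0 < lambda_min A"
proof -
  let ?S = "{l. \<exists>v. v \<noteq> 0 \<and> A *v v = l *\<^sub>R v}"
  have "?S \<noteq> {}" using symmetric_matrix_eigenvalue_exists[OF sym] by blast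
  moreover have "0 < l" if "l \<in> ?S" for l
  proof -
    obtain v where "v \<noteq> 0" "A *v v = l *\<^sub>R v" using \<open>l \<in> ?S\<close> by blast
    then have "0 < l * (v \<bullet> v)" using pos[of v] by simp
    then show ?thesis using \<open>v \<noteq> 0\<close> by (auto dest: zero_less_mult_pos2)
  qed
  ultimately show ?thesis
    unfolding lambda_min_def using Min_gr_iff[OF symmetric_matrix_eigenvalues_finite[OF sym]] by blast
qed

section \<open>Integrals of Gram matrices over an arbitrary measure\<close>

text \<open>For fixed \<open>x\<close> and \<open>y\<close> the map from \<open>A\<close> to
  \<open>x \<bullet> (A *v y)\<close> is a bounded linear functional, so it commutes with the
  matrix-valued integral.\<close>

lemma inner_integral_gram_matrix:
  fixes J :: "'b \<Rightarrow> real ^ 'd ^ 'n"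
  assumes "integrable N (\<lambda>t. transpose (J t) ** J t)"
  shows "integrable N (\<lambda>t. (J t *v x) \<bullet> (J t *v y))"
    and "x \<bullet> ((LINT t|N. transpose (J t) ** J t) *v y) = (LINT t|N. (J t *v x) \<bullet> (J t *v y))"
proof -
  have "linear (\<lambda>A :: real ^ 'd ^ 'd. x \<bullet> (A *v y))"
    by (rule linearI) (simp_all add: matrix_vector_mult_add_rdistrib inner_add_right
        scaleR_matrix_vector_assoc[symmetric])
  then have bl: "bounded_linear (\<lambda>A :: real ^ 'd ^ 'd. x \<bullet> (A *v y))"
    by (simp add: linear_linear)
  have eq: "x \<bullet> ((transpose (J t) ** J t) *v y) = (J t *v x) \<bullet> (J t *v y)" for t
    by (metis dot_lmul_matrix inner_commute matrix_vector_mul_assoc transpose_matrix_vector)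
  show "integrable N (\<lambda>t. (J t *v x) \<bullet> (J t *v y))"
    using integrable_bounded_linear[OF bl assms] by (simp only: eq)
  show "x \<bullet> ((LINT t|N. transpose (J t) ** J t) *v y) = (LINT t|N. (J t *v x) \<bullet> (J t *v y))"
    using integral_bounded_linear[OF bl assms] by (simp only: eq)
qed

lemma lambda_min_integral_gram_matrix_pos:
  fixes J :: "'b \<Rightarrow> real ^ 'd ^ 'n"
  assumes int: "integrable N (\<lambda>t. transpose (J t) ** J t)"
    and nondeg: "\<And>u. norm u = 1 \<Longrightarrow> \<not> (AE t in N. J t *v u = 0)"
  shows "0 < lambda_min (LINT t|N. transpose (J t) ** J t)"
proof (rule lambda_min_pos)
  fix x y
  let ?W = "LINT t|N. transpose (J t) ** J t"
  show "x \<bullet> (?W *v y) = (?W *v x) \<bullet> y"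
    using inner_integral_gram_matrix(2)[OF int, of x y] inner_integral_gram_matrix(2)[OF int, of y x]
    by (simp add: inner_commute)
  assume "x \<noteq> 0"
  have eq: "x \<bullet> (?W *v x) = (LINT t|N. (J t *v x) \<bullet> (J t *v x))"
    by (rule inner_integral_gram_matrix(2)[OF int])
  have "(LINT t|N. (J t *v x) \<bullet> (J t *v x)) \<noteq> 0"
  proof
    assume "(LINT t|N. (J t *v x) \<bullet> (J t *v x)) = 0"
    then have "AE t in N. J t *v x = 0"
      by (subst (asm) integral_nonneg_eq_0_iff_AE[OF inner_integral_gram_matrix(1)[OF int]]) auto
    \<comment> \<open>\<open>nondeg\<close> speaks of unit vectors only, hence the rescaling of
      \<open>x\<close>.\<close>
    then have "AE t in N. J t *v (x /\<^sub>R norm x) = 0"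
      by eventually_elim (simp add: matrix_vector_mult_scaleR)
    then show False using nondeg[of "x /\<^sub>R norm x"] \<open>x \<noteq> 0\<close> by simp
  qed
  moreover have "0 \<le> (LINT t|N. (J t *v x) \<bullet> (J t *v x))"
    by (rule integral_nonneg_AE) auto
  ultimately show "0 < x \<bullet> (?W *v x)" using eq by linarith
qed

section \<open>Differentiation under the integral sign\<close>

text \<open>Writing the derivative as the limit of a sequence lets measurability pass from
  difference quotients to derivatives. It serves both the gradient in \<open>\<theta>\<close> and
  the Jacobian along the trajectory.\<close>

lemma has_derivative_directional_LIMSEQ:
  fixes F :: "'a::real_normed_vector \<Rightarrow> 'b::real_normed_vector"
  assumes F: "(F has_derivative F') (at x)"
    and s: "s \<longlonglongrightarrow> 0" "\<And>n. s n > (0::real)"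
  shows "(\<lambda>n. (F (x + s n *\<^sub>R u) - F x) /\<^sub>R s n) \<longlonglongrightarrow> F' u"
proof -
  \<comment> \<open>The base point is put in the form that the chain rule expects at
    \<open>t = 0\<close>.\<close>
  have "(F has_derivative F') (at (x + 0 *\<^sub>R u))" using F by simp
  then have "((\<lambda>t. F (x + t *\<^sub>R u)) has_derivative (\<lambda>t. F' (t *\<^sub>R u))) (at 0)"
    by (rule has_derivative_compose[rotated]) (auto intro!: derivative_eq_intros)
  then have "((\<lambda>t. norm (F (x + t *\<^sub>R u) - F x - t *\<^sub>R F' u) / norm t) \<longlongrightarrow> 0) (at 0)"
    using linear_scale[OF has_derivative_linear[OF F]] by (simp add: has_derivative_iff_norm)
  moreover have "\<forall>\<^sub>F t in at (0::real). norm (F (x + t *\<^sub>R u) - F x - t *\<^sub>R F' u) / norm t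
      = norm ((F (x + t *\<^sub>R u) - F x) /\<^sub>R t - F' u)"
  proof (rule eventually_at_filter[THEN iffD2], rule always_eventually, intro allI impI)
    fix t :: real assume "t \<noteq> 0"
    then have eq: "(F (x + t *\<^sub>R u) - F x) /\<^sub>R t - F' u = (F (x + t *\<^sub>R u) - F x - t *\<^sub>R F' u) /\<^sub>R t"
      by (simp add: scaleR_diff_right)
    show "norm (F (x + t *\<^sub>R u) - F x - t *\<^sub>R F' u) / norm t
        = norm ((F (x + t *\<^sub>R u) - F x) /\<^sub>R t - F' u)"
      unfolding eq norm_scaleR real_norm_def by (simp only: abs_inverse divide_inverse mult.commute)
  qed
  ultimately have "((\<lambda>t. (F (x + t *\<^sub>R u) - F x) /\<^sub>R t) \<longlongrightarrow> F' u) (at 0)"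
    by (rule Lim_transform_eventually[THEN tendsto_norm_zero_cancel, THEN LIM_zero_cancel])
  moreover have "filterlim s (at 0) sequentially"
    using s by (auto simp: filterlim_at less_imp_neq[symmetric] intro!: always_eventually)
  ultimately show ?thesis by (rule filterlim_compose)
qed

text \<open>The remainder quotient tends to 0 pointwise and is dominated by \<open>2 * h\<close>, so
  its integral tends to 0. The exceptional null set in \<open>deriv\<close> is common to all
  \<open>q\<close> in \<open>U\<close>, which permits the mean value inequality for each remaining
  \<open>\<theta>\<close>.\<close>

lemma gderiv_integral_dominated:
  fixes f :: "'a::euclidean_space \<Rightarrow> 'b \<Rightarrow> real"
  assumes U: "open U" "p \<in> U"
    and int: "\<And>q. q \<in> U \<Longrightarrow> integrable M (f q)"
    and h: "integrable M h"
    and deriv: "AE \<theta> in M. \<forall>q\<in>U. \<exists>g. (GDERIV (\<lambda>q. f q \<theta>) q :> g) \<and> norm g \<le> h \<theta>"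
  shows "\<exists>G. (GDERIV (\<lambda>q. LINT \<theta>|M. f q \<theta>) p :> G) \<and> norm G \<le> (LINT \<theta>|M. h \<theta>)"
proof -
  obtain e where e: "e > 0" "ball p e \<subseteq> U"
    using U openE by blast
  \<comment> \<open>The offset 2 gives \<open>s n < e\<close> already at \<open>n = 0\<close>, so
    all sample points stay in the ball.\<close>
  define s where "s n = e / real (n + 2)" for n
  have s_pos: "s n > 0" and s_less: "s n < e" for n
    using e(1) by (simp_all add: s_def divide_simps)
  have s_lim: "s \<longlonglongrightarrow> 0"
    unfolding s_def using LIMSEQ_ignore_initial_segment[OF lim_const_over_n[of e], of 2] by simp
  text \<open>An explicit version of the gradient that is measurable in \<open>\<theta>\<close>.\<close>
  define G where
    "G \<theta> = (\<Sum>b\<in>Basis. lim (\<lambda>n. (f (p + s n *\<^sub>R b) \<theta> - f p \<theta>) /\<^sub>R s n) *\<^sub>R b)" for \<theta>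
  have meas: "f q \<in> borel_measurable M" if "q \<in> U" for q
    using int[OF that] by simp
  have "p + s n *\<^sub>R b \<in> U" if "b \<in> Basis" for n b
  proof -
    have "dist p (p + s n *\<^sub>R b) < e"
      using s_less[of n] s_pos[of n] that by (simp add: dist_norm)
    then show ?thesis using e(2) by auto
  qed
  then have G_meas[measurable]: "G \<in> borel_measurable M"
    unfolding G_def using meas U(2)
    by (intro borel_measurable_sum borel_measurable_scaleR borel_measurable_const
        borel_measurable_lim_metric borel_measurable_diff) auto
  have AE_G: "AE \<theta> in M. (GDERIV (\<lambda>q. f q \<theta>) p :> G \<theta>) \<and> norm (G \<theta>) \<le> h \<theta> \<and>
      (\<forall>q\<in>ball p e. \<bar>f q \<theta> - f p \<theta>\<bar> \<le> h \<theta> * norm (q - p))"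
    using deriv
  proof eventually_elim
    case (elim \<theta>)
    obtain g where g: "\<And>q. q \<in> U \<Longrightarrow> GDERIV (\<lambda>q. f q \<theta>) q :> g q"
      and g_le: "\<And>q. q \<in> U \<Longrightarrow> norm (g q) \<le> h \<theta>"
      using elim by metis
    \<comment> \<open>At such a \<open>\<theta>\<close> the quotients converge, so
      \<open>lim\<close> returns the true partial derivatives. On the exceptional null set its value
      is irrelevant.\<close>
    have "lim (\<lambda>n. (f (p + s n *\<^sub>R b) \<theta> - f p \<theta>) /\<^sub>R s n) = b \<bullet> g p" for b
      by (rule limI, rule has_derivative_directional_LIMSEQ[OF g[OF U(2), unfolded gderiv_def] s_lim s_pos])
    then have "G \<theta> = g p"
      unfolding G_def using euclidean_representation[of "g p"] by (simp add: inner_commute)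
    moreover have "\<bar>f q \<theta> - f p \<theta>\<bar> \<le> h \<theta> * norm (q - p)" if q: "q \<in> ball p e" for q
    proof -
      \<comment> \<open>The mean value inequality needs a convex domain, hence the ball in place of
        \<open>U\<close>.\<close>
      have "norm (f q \<theta> - f p \<theta>) \<le> h \<theta> * norm (q - p)"
      proof (rule differentiable_bound[where S = "ball p e" and f' = "\<lambda>x v. v \<bullet> g x"])
        fix x assume "x \<in> ball p e"
        then have x: "x \<in> U" using e(2) by blast
        show "((\<lambda>q. f q \<theta>) has_derivative (\<lambda>v. v \<bullet> g x)) (at x within ball p e)"
          using g[OF x] by (simp add: gderiv_def has_derivative_at_withinI)
        have "norm (v \<bullet> g x) \<le> h \<theta> * norm v" for v
          using Cauchy_Schwarz_ineq2[of v "g x"] mult_left_mono[OF g_le[OF x], of "norm v"]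
          by (simp add: mult.commute)
        then show "onorm (\<lambda>v. v \<bullet> g x) \<le> h \<theta>"
          by (intro onorm_bound) (use g_le[OF x] norm_ge_zero order_trans in blast)
      qed (use q e(1) in auto)
      then show ?thesis by simp
    qed
    ultimately show ?case using g[OF U(2)] g_le[OF U(2)] by simp
  qed
  have G_int: "integrable M G"
    by (rule Bochner_Integration.integrable_bound[OF h G_meas]) (use AE_G in \<open>auto elim: eventually_mono\<close>)
  have "norm (integral\<^sup>L M G) \<le> (LINT \<theta>|M. norm (G \<theta>))"
    by (rule integral_norm_bound)
  also have "\<dots> \<le> (LINT \<theta>|M. h \<theta>)"
    by (rule integral_mono_AE) (use G_int h AE_G in auto)
  finally have "norm (integral\<^sup>L M G) \<le> (LINT \<theta>|M. h \<theta>)" .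
  moreover have "GDERIV (\<lambda>q. LINT \<theta>|M. f q \<theta>) p :> integral\<^sup>L M G"
    unfolding gderiv_def has_derivative_at_within
  proof (intro conjI)
    show "bounded_linear (\<lambda>v. v \<bullet> integral\<^sup>L M G)"
      by (rule bounded_linear_inner_left)
    define R where "R q \<theta> = (f q \<theta> - f p \<theta> - (q - p) \<bullet> G \<theta>) /\<^sub>R norm (q - p)" for q \<theta>
    have R_eq: "((LINT \<theta>|M. f q \<theta>) - (LINT \<theta>|M. f p \<theta>) - (q - p) \<bullet> integral\<^sup>L M G) /\<^sub>R norm (q - p)
        = (LINT \<theta>|M. R q \<theta>)" if "q \<in> U" for q
      using int[OF that] int[OF U(2)] G_int by (simp add: R_def)
    have "(\<lambda>q. LINT \<theta>|M. R q \<theta>) \<midarrow>p\<rightarrow> 0"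
      \<comment> \<open>Dominated convergence is a statement about sequences, so the limit at
        \<open>p\<close> is tested along sequences avoiding \<open>p\<close>.\<close>
      unfolding LIMSEQ_SEQ_conv[symmetric]
    proof (intro allI impI)
      fix X assume X: "(\<forall>n. X n \<noteq> p) \<and> X \<longlonglongrightarrow> p"
      then have "\<forall>\<^sub>F n in sequentially. X n \<in> ball p e"
        using topological_tendstoD[of X p sequentially "ball p e"] e(1) by simp
      then obtain N where N: "\<And>n. n \<ge> N \<Longrightarrow> X n \<in> ball p e"
        by (auto simp: eventually_sequentially)
      \<comment> \<open>Shifting by \<open>N\<close> puts every term in the ball, where
        measurability and the domination hold. \<open>LIMSEQ_offset\<close> undoes the
        shift.\<close>
      have lim0: "(\<lambda>n. LINT \<theta>|M. R (X (n + N)) \<theta>) \<longlonglongrightarrow> (LINT \<theta>|M. 0)"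
      proof (rule integral_dominated_convergence[where w = "\<lambda>\<theta>. 2 * h \<theta>"])
        show "integrable M (\<lambda>\<theta>. 2 * h \<theta>)" using h by simp
        show "R (X (n + N)) \<in> borel_measurable M" for n
          unfolding R_def using meas[of "X (n + N)"] meas[OF U(2)] N[of "n + N"] e(2)
          by (intro borel_measurable_scaleR borel_measurable_diff borel_measurable_inner) auto
        show "AE \<theta> in M. (\<lambda>n. R (X (n + N)) \<theta>) \<longlonglongrightarrow> 0"
          using AE_G
        proof eventually_elim
          case (elim \<theta>)
          then have "(\<lambda>q. R q \<theta>) \<midarrow>p\<rightarrow> 0"
            by (simp add: gderiv_def has_derivative_at_within R_def)
          then have "(\<lambda>n. R (X n) \<theta>) \<longlonglongrightarrow> 0"
            using X unfolding LIMSEQ_SEQ_conv[symmetric] by blast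
          then show ?case by (rule LIMSEQ_ignore_initial_segment)
        qed
        show "AE \<theta> in M. norm (R (X (n + N)) \<theta>) \<le> 2 * h \<theta>" for n
          using AE_G
        proof eventually_elim
          case (elim \<theta>)
          let ?q = "X (n + N)"
          \<comment> \<open>The factor 2 collects one \<open>h \<theta>\<close> from the mean value
            inequality and one from Cauchy-Schwarz.\<close>
          have "\<bar>f ?q \<theta> - f p \<theta>\<bar> \<le> h \<theta> * norm (?q - p)"
            using elim N[of "n + N"] by simp
          moreover have "\<bar>(?q - p) \<bullet> G \<theta>\<bar> \<le> h \<theta> * norm (?q - p)"
            using Cauchy_Schwarz_ineq2[of "?q - p" "G \<theta>"] elim
              mult_left_mono[of "norm (G \<theta>)" "h \<theta>" "norm (?q - p)"]
            by (simp add: mult.commute)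
          ultimately have "\<bar>f ?q \<theta> - f p \<theta> - (?q - p) \<bullet> G \<theta>\<bar> \<le> 2 * h \<theta> * norm (?q - p)"
            by linarith
          then show ?case
            using X by (simp add: R_def divide_simps abs_mult)
        qed
      qed simp
      then show "(\<lambda>n. LINT \<theta>|M. R (X n) \<theta>) \<longlonglongrightarrow> 0"
        using LIMSEQ_offset[of "\<lambda>n. LINT \<theta>|M. R (X n) \<theta>" N 0] by simp
    qed
    moreover have "\<forall>\<^sub>F q in at p. q \<in> U"
      using U eventually_at_topological by blast
    then have "\<forall>\<^sub>F q in at p. (LINT \<theta>|M. R q \<theta>) =
        ((LINT \<theta>|M. f q \<theta>) - (LINT \<theta>|M. f p \<theta>) - (q - p) \<bullet> integral\<^sup>L M G) /\<^sub>R norm (q - p)"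
      by eventually_elim (rule R_eq[symmetric])
    ultimately show "(\<lambda>q. ((LINT \<theta>|M. f q \<theta>) - (LINT \<theta>|M. f p \<theta>) - (q - p) \<bullet> integral\<^sup>L M G)
        /\<^sub>R norm (q - p)) \<midarrow>p\<rightarrow> 0"
      by (rule Lim_transform_eventually)
  qed
  ultimately show ?thesis by blast
qed

section \<open>Measurability and integrability of the Jacobian\<close>

lemma borel_measurable_frechet_derivative:
  fixes F :: "'a::euclidean_space \<Rightarrow> 'b::euclidean_space"
  assumes U: "open U" and F: "\<And>x. x \<in> U \<Longrightarrow> F differentiable (at x)"
  shows "(\<lambda>x. indicator U x *\<^sub>R frechet_derivative F (at x) u) \<in> borel_measurable borel"
proof (rule borel_measurable_LIMSEQ_metric)
  \<comment> \<open>\<open>F\<close> is controlled only on \<open>U\<close>, and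
    \<open>x + ?s n *\<^sub>R u\<close> may leave \<open>U\<close>. The extension by zero is Borel
    on the whole space and, as \<open>U\<close> is open, has the same derivative at points of
    \<open>U\<close>.\<close>
  define F0 where "F0 x = indicator U x *\<^sub>R F x" for x
  let ?s = "\<lambda>n. inverse (real (Suc n))"
  have "continuous_on U F"
    using F by (intro differentiable_imp_continuous_on)
      (auto simp: differentiable_on_def intro: differentiable_at_withinI)
  then have [measurable]: "F0 \<in> borel_measurable borel"
    unfolding F0_def using U by (intro borel_measurable_continuous_on_indicator) auto
  have [measurable]: "U \<in> sets borel" using U by simp
  show "(\<lambda>x. indicator U x *\<^sub>R ((F0 (x + ?s n *\<^sub>R u) - F0 x) /\<^sub>R ?s n)) \<in> borel_measurable borel" for n
    by measurable
  fix x :: 'a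
  show "(\<lambda>n. indicator U x *\<^sub>R ((F0 (x + ?s n *\<^sub>R u) - F0 x) /\<^sub>R ?s n))
      \<longlonglongrightarrow> indicator U x *\<^sub>R frechet_derivative F (at x) u"
  proof (cases "x \<in> U")
    case True
    have "(F has_derivative frechet_derivative F (at x)) (at x)"
      using F[OF True] frechet_derivative_works by blast
    then have "(F0 has_derivative frechet_derivative F (at x)) (at x)"
      by (rule has_derivative_transform_within_open[OF _ U True]) (simp add: F0_def)
    then have "(\<lambda>n. (F0 (x + ?s n *\<^sub>R u) - F0 x) /\<^sub>R ?s n) \<longlonglongrightarrow> frechet_derivative F (at x) u"
      by (rule has_derivative_directional_LIMSEQ) (use LIMSEQ_inverse_real_of_nat in auto)
    then show ?thesis using True by simp
  qed simp
qed

text \<open>Bounded measurable functions are integrable over a bounded interval. This is applied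
  entry by entry, and the matrix is reassembled from its coordinates in
  \<open>Basis\<close>.\<close>

lemma integrable_gram_jacobian:
  fixes F :: "real ^ 'd \<Rightarrow> real ^ 'n" and c :: "real \<Rightarrow> real ^ 'd"
  assumes U: "open U" and c: "continuous_on {a..b} c" "c ` {a..b} \<subseteq> U"
    and F: "\<And>x. x \<in> U \<Longrightarrow> F differentiable (at x)"
    and bound: "\<And>x u. x \<in> U \<Longrightarrow> norm (frechet_derivative F (at x) u) \<le> B * norm u"
  shows "integrable (lebesgue_on {a..b})
    (\<lambda>t. transpose (jacobian F (at (c t))) ** jacobian F (at (c t)))"
proof -
  let ?L = "lebesgue_on {a..b}"
  let ?J = "\<lambda>t. jacobian F (at (c t))"
  let ?A = "\<lambda>t. transpose (?J t) ** ?J t"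
  have J: "?J t *v u = frechet_derivative F (at (c t)) u" if "t \<in> {a..b}" for t u
    using F[of "c t"] c(2) that by (metis frechet_derivative_at image_subset_iff jacobian_works)
  have meas: "(\<lambda>t. ?J t *v u) \<in> borel_measurable ?L" for u
  proof -
    have "c \<in> borel_measurable ?L"
      using c(1) by (intro continuous_imp_measurable_on_sets_lebesgue) auto
    then have "(\<lambda>t. indicator U (c t) *\<^sub>R frechet_derivative F (at (c t)) u) \<in> borel_measurable ?L"
      using borel_measurable_frechet_derivative[OF U F] by (rule measurable_compose)
    \<comment> \<open>The curve stays in \<open>U\<close>, so the indicator is 1 along it.\<close>
    moreover have eq: "indicator U (c t) *\<^sub>R frechet_derivative F (at (c t)) u = ?J t *v u"
      if "t \<in> space ?L" for t
    proof -
      have "t \<in> {a..b}" using that by simp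
      then show ?thesis using c(2) J[of t u] by (simp add: image_subset_iff)
    qed
    ultimately show ?thesis by (simp only: measurable_cong[OF eq])
  qed
  have comp: "integrable ?L (\<lambda>t. ?A t \<bullet> axis i (axis j 1))" for i j
  proof -
    \<comment> \<open>An entry of a Gram matrix is the inner product of two columns of
      \<open>?J t\<close>. Each column is the image of a unit vector, so its norm is at most
      \<open>B\<close>.\<close>
    have eq: "?A t \<bullet> axis i (axis j 1) = (?J t *v axis i 1) \<bullet> (?J t *v axis j 1)" for t
    proof -
      have "?A t \<bullet> axis i (axis j 1) = ?A t $ i $ j" by (simp add: inner_axis)
      then show ?thesis
        by (simp add: matrix_vector_mult_basis matrix_matrix_mult_def transpose_def
            inner_vec_def column_def)
    qed
    have "integrable ?L (\<lambda>t. (?J t *v axis i 1) \<bullet> (?J t *v axis j 1))"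
    proof (rule finite_measure.integrable_const_bound)
      show "finite_measure ?L" by (simp add: finite_measure_lebesgue_on)
      show "(\<lambda>t. (?J t *v axis i 1) \<bullet> (?J t *v axis j 1)) \<in> borel_measurable ?L"
        using meas by (intro borel_measurable_inner)
      show "AE t in ?L. norm ((?J t *v axis i 1) \<bullet> (?J t *v axis j 1)) \<le> B * B"
      proof (rule AE_I2)
        fix t assume "t \<in> space ?L"
        then have t: "t \<in> {a..b}" by simp
        have "norm (?J t *v axis k 1) \<le> B" for k
          using bound[of "c t" "axis k 1"] c(2) t J[OF t] by (simp add: image_subset_iff)
        then have "norm (?J t *v axis i 1) * norm (?J t *v axis j 1) \<le> B * B"
          by (intro mult_mono) (auto intro: order_trans[OF norm_ge_zero])
        then show "norm ((?J t *v axis i 1) \<bullet> (?J t *v axis j 1)) \<le> B * B"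
          using Cauchy_Schwarz_ineq2 order_trans by (metis real_norm_def)
      qed
    qed
    then show ?thesis by (simp add: eq)
  qed
  have "integrable ?L (\<lambda>t. \<Sum>m\<in>Basis. (?A t \<bullet> m) *\<^sub>R m)"
    by (intro Bochner_Integration.integrable_sum Bochner_Integration.integrable_scaleR_left)
       (auto simp: Basis_vec_def comp)
  then show ?thesis by (simp add: euclidean_representation)
qed

section \<open>The descriptor map\<close>

lemma descriptor_weight_nonneg: "0 \<le> descriptor_weight D \<epsilon> i \<theta>"
  by (simp add: descriptor_weight_def sum_nonneg)

lemma descriptor_weight_le_1: "descriptor_weight D \<epsilon> i \<theta> \<le> 1"
proof -
  have "0 < (\<Sum>j\<in>UNIV. exp (\<theta> \<bullet> D j / \<epsilon>))" by (intro sum_pos) auto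
  moreover have "exp (\<theta> \<bullet> D i / \<epsilon>) \<le> (\<Sum>j\<in>UNIV. exp (\<theta> \<bullet> D j / \<epsilon>))"
    by (rule member_le_sum) auto
  ultimately show ?thesis by (simp add: descriptor_weight_def)
qed

lemma descriptor_weight_measurable: "descriptor_weight D \<epsilon> i \<in> borel_measurable sphere_measure"
proof -
  have "descriptor_weight D \<epsilon> i \<in> borel_measurable (restrict_space borel (sphere 0 1))"
    unfolding descriptor_weight_def by (intro measurable_restrict_space1) measurable
  then show ?thesis
    using measurable_cong_sets[OF sets_sphere_measure refl] by blast
qed

text \<open>The softmax weights lie between 0 and 1, so multiplying the signal by one preserves
  integrability and the gradient bound \<open>h\<close>. Differentiation under the integral then
  applies to each component, with a bound uniform on \<open>U\<close>.\<close>

lemma descriptor_map_differentiable: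
  fixes D :: "'n::finite \<Rightarrow> real ^ 'd"
  assumes "admissible_signal M f"
  obtains U B where "open U" "M \<subseteq> U"
    "\<And>p. p \<in> U \<Longrightarrow> descriptor_map D \<epsilon> f differentiable (at p)"
    "\<And>p u. p \<in> U \<Longrightarrow>
      norm (frechet_derivative (descriptor_map D \<epsilon> f) (at p) u) \<le> B * norm u"
proof -
  let ?S = "sphere_measure :: (real ^ 'd) measure"
  let ?w = "descriptor_weight D \<epsilon>"
  let ?F = "descriptor_map D \<epsilon> f"
  obtain U h where U: "open U" "M \<subseteq> U" and int: "\<And>p. p \<in> U \<Longrightarrow> integrable ?S (f p)"
    and h: "integrable ?S h"
    and deriv: "AE \<theta> in ?S. \<forall>p\<in>U. \<exists>g. (GDERIV (\<lambda>q. f q \<theta>) p :> g) \<and> norm g \<le> h \<theta>"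
    using assms unfolding admissible_signal_def by blast
  define C where "C = (LINT \<theta>|?S. h \<theta>)"
  have comp: "\<exists>G. (GDERIV (\<lambda>q. ?F q $ i) p :> G) \<and> norm G \<le> C" if "p \<in> U" for p i
    unfolding descriptor_map_def vec_lambda_beta C_def
  proof (rule gderiv_integral_dominated[OF U(1) that _ h])
    show "integrable ?S (\<lambda>\<theta>. f q \<theta> * ?w i \<theta>)" if "q \<in> U" for q
    proof (rule Bochner_Integration.integrable_bound[OF int[OF that]])
      show "(\<lambda>\<theta>. f q \<theta> * ?w i \<theta>) \<in> borel_measurable ?S"
        using int[OF that] descriptor_weight_measurable by (intro borel_measurable_times) auto
      show "AE \<theta> in ?S. norm (f q \<theta> * ?w i \<theta>) \<le> norm (f q \<theta>)"
        using descriptor_weight_nonneg[of D \<epsilon> i] descriptor_weight_le_1[of D \<epsilon> i]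
        by (intro AE_I2) (simp add: abs_mult mult_left_le)
    qed
    show "AE \<theta> in ?S. \<forall>q\<in>U. \<exists>g. (GDERIV (\<lambda>q. f q \<theta> * ?w i \<theta>) q :> g) \<and> norm g \<le> h \<theta>"
      using deriv
    proof eventually_elim
      case (elim \<theta>)
      show ?case
      proof
        fix q assume "q \<in> U"
        then obtain g where g: "GDERIV (\<lambda>q. f q \<theta>) q :> g" "norm g \<le> h \<theta>"
          using elim by blast
        have "((\<lambda>q. f q \<theta> * ?w i \<theta>) has_derivative (\<lambda>v. v \<bullet> g * ?w i \<theta>)) (at q)"
          using g(1) unfolding gderiv_def by (rule has_derivative_mult_left)
        then have "GDERIV (\<lambda>q. f q \<theta> * ?w i \<theta>) q :> ?w i \<theta> *\<^sub>R g"
          by (simp add: gderiv_def mult.commute)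
        moreover have "norm (?w i \<theta> *\<^sub>R g) \<le> h \<theta>"
          using g(2) descriptor_weight_nonneg[of D \<epsilon> i \<theta>] descriptor_weight_le_1[of D \<epsilon> i \<theta>]
          by (auto intro: order_trans[OF mult_left_le_one_le])
        ultimately show "\<exists>g. (GDERIV (\<lambda>q. f q \<theta> * ?w i \<theta>) q :> g) \<and> norm g \<le> h \<theta>"
          by blast
      qed
    qed
  qed
  then obtain G where G: "\<And>p i. p \<in> U \<Longrightarrow> GDERIV (\<lambda>q. ?F q $ i) p :> G p i"
    and G_le: "\<And>p i. p \<in> U \<Longrightarrow> norm (G p i) \<le> C"
    by metis
  have F: "(?F has_derivative (\<lambda>v. \<chi> i. v \<bullet> G p i)) (at p)" if "p \<in> U" for p
    using G[OF that] unfolding gderiv_def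
    by (subst has_derivative_componentwise_within)
       (auto simp: Basis_vec_def inner_axis)
  show thesis
  proof (rule that[OF U])
    fix p u assume p: "p \<in> U"
    show "?F differentiable (at p)" using F[OF p] differentiable_def by blast
    \<comment> \<open>Passing to the l1 norm costs a factor \<open>CARD('n)\<close>, whence the
      constant \<open>real CARD('n) * C\<close>.\<close>
    have "norm (\<chi> i. u \<bullet> G p i) \<le> (\<Sum>i\<in>UNIV. \<bar>u \<bullet> G p i\<bar>)"
      using norm_le_l1_cart[of "\<chi> i. u \<bullet> G p i"] by simp
    also have "\<dots> \<le> (\<Sum>i\<in>(UNIV :: 'n set). C * norm u)"
    proof (rule sum_mono)
      fix i
      show "\<bar>u \<bullet> G p i\<bar> \<le> C * norm u"
        using Cauchy_Schwarz_ineq2[of u "G p i"] mult_left_mono[OF G_le[OF p, of i], of "norm u"]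
        by (simp add: mult.commute)
    qed
    also have "\<dots> = (real CARD('n) * C) * norm u" by simp
    finally show "norm (frechet_derivative ?F (at p) u) \<le> (real CARD('n) * C) * norm u"
      using frechet_derivative_at[OF F[OF p]] by metis
  qed
qed

theorem proposition8:
  fixes M :: "(real ^ 'd) set"
    and D :: "'n::finite \<Rightarrow> real ^ 'd"
    and \<epsilon> :: real
    and f :: "real ^ 'd \<Rightarrow> real ^ 'd \<Rightarrow> real"
    and F :: "real ^ 'd \<Rightarrow> real ^ 'n"
    and T :: real
    and p :: "real \<Rightarrow> real ^ 'd"
  assumes "CARD('d) \<in> {2, 3}"
    and "\<And>i. norm (D i) = 1"
    and "\<epsilon> > 0"
    and "admissible_signal M f"
    and "F = descriptor_map D \<epsilon> f"
    and "T > 0"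
    and "C1_trajectory M T p"
    and "generic F T p"
  shows "lambda_min (observability_gramian F T p) > 0"
proof -
  obtain U B where U: "open U" "M \<subseteq> U" and F: "\<And>x. x \<in> U \<Longrightarrow> F differentiable (at x)"
    and B: "\<And>x u. x \<in> U \<Longrightarrow> norm (frechet_derivative F (at x) u) \<le> B * norm u"
    using descriptor_map_differentiable[OF \<open>admissible_signal M f\<close>] \<open>F = descriptor_map D \<epsilon> f\<close>
    by metis
  have "continuous_on {0..T} p"
    using \<open>C1_trajectory M T p\<close> unfolding C1_trajectory_def
    by (meson continuous_on_eq_continuous_within has_vector_derivative_continuous)
  moreover have "p ` {0..T} \<subseteq> U"
    using \<open>C1_trajectory M T p\<close> U(2) unfolding C1_trajectory_def by blast
  ultimately have "integrable (lebesgue_on {0..T})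
      (\<lambda>t. transpose (jacobian F (at (p t))) ** jacobian F (at (p t)))"
    using integrable_gram_jacobian[OF U(1) _ _ F B] by blast
  then show ?thesis
    unfolding observability_gramian_def
    \<comment> \<open>Genericity is the nondegeneracy premise for the measure
      \<open>lebesgue_on {0..T}\<close>.\<close>
    by (rule lambda_min_integral_gram_matrix_pos)
       (use \<open>generic F T p\<close> in \<open>auto simp: generic_def degenerate_def\<close>)
qed

end
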